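(* Let $s\ge 2$, let $G$ be a metric star consisting of $s$ spikes of length one, and let $G_w$ be any graph obtained by adding $s-2$ wormholes to $G$. Then $\mathrm{diam}(G_w)=\mathrm{diam}(G)=2$.
   Context: A metric graph is a finite edge-weighted graph regarded as a metric space in which all points in the interior of each edge are included and each edge is locally isometric to an interval whose length is the edge weight; $d_G(x,y)$ is the minimum length of a path from $x$ to $y$, and $\mathrm{diam}(G)=\max_{x,y\in G} d_G(x,y)$ over all points of $G$ (not only vertices). The metric star with $s$ spikes of length one consists of $s$ intervals of length $1$ glued at a common endpoint. A wormhole is a pair of points of $G$ (arbitrary points, not necessarily vertices); adding a wormhole means identifying its two points, equivalently adding an edge of length zero between them. $G_w$ is the metric graph obtained after all the identifications. Different wormholes may share points. *)

theory Defs
  imports Complex_Main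
begin

text \<open>
  A metric graph is given by a finite family of closed intervals \<open>[0, len e]\<close>, one for each edge
  \<open>e\<close>, together with finitely many pairs of places on these intervals that are glued together.
  A place is written \<open>(e, t)\<close> with \<open>0 \<le> t \<le> len e\<close>. The relation \<open>glue\<close> only generates the
  identification: the points of the graph are the classes of its equivalence closure. A gluing
  may involve interior places, so the result of identifying points is again of this form.
\<close>

record 'e mgraph =
  edges :: "'e set"
  len :: "'e \<Rightarrow> real"
  glue :: "(('e \<times> real) \<times> ('e \<times> real)) set"

definition places :: "('e, 'x) mgraph_scheme \<Rightarrow> ('e \<times> real) set" where
  "places G = (SIGMA e : edges G. {0..len G e})"

definition same_point :: "('e, 'x) mgraph_scheme \<Rightarrow> (('e \<times> real) \<times> ('e \<times> real)) set" where
  "same_point G = (glue G \<union> (glue G)\<inverse>)\<^sup>* \<inter> places G \<times> places G"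

definition points :: "('e, 'x) mgraph_scheme \<Rightarrow> ('e \<times> real) set set" where
  "points G = places G // same_point G"

text \<open>
  A path is a nonempty list of segments. The segment \<open>(e, a, b)\<close> runs along the edge \<open>e\<close> from
  \<open>(e, a)\<close> to \<open>(e, b)\<close>, in either direction, and each segment starts at the point where the
  preceding one ends. Segments with \<open>a = b\<close> are allowed, so constant paths exist.
\<close>

fun seg_start :: "'e \<times> real \<times> real \<Rightarrow> 'e \<times> real" where
  "seg_start (e, a, b) = (e, a)"

fun seg_end :: "'e \<times> real \<times> real \<Rightarrow> 'e \<times> real" where
  "seg_end (e, a, b) = (e, b)"

fun seg_length :: "'e \<times> real \<times> real \<Rightarrow> real" where
  "seg_length (e, a, b) = \<bar>b - a\<bar>"

definition path_from_to ::
    "('e, 'x) mgraph_scheme \<Rightarrow> ('e \<times> real) set \<Rightarrow> ('e \<times> real) set \<Rightarrow> ('e \<times> real \<times> real) list \<Rightarrow> bool"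
  where
  "path_from_to G X Y \<gamma> \<longleftrightarrow>
     \<gamma> \<noteq> [] \<and>
     (\<forall>\<sigma>\<in>set \<gamma>. seg_start \<sigma> \<in> places G \<and> seg_end \<sigma> \<in> places G) \<and>
     successively (\<lambda>\<sigma> \<tau>. (seg_end \<sigma>, seg_start \<tau>) \<in> same_point G) \<gamma> \<and>
     seg_start (hd \<gamma>) \<in> X \<and> seg_end (last \<gamma>) \<in> Y"

definition path_length :: "('e \<times> real \<times> real) list \<Rightarrow> real" where
  "path_length \<gamma> = sum_list (map seg_length \<gamma>)"

text \<open>In a \<open>metric_graph\<close> (defined below) the following infimum is attained by a shortest path.\<close>

definition graph_dist ::
    "('e, 'x) mgraph_scheme \<Rightarrow> ('e \<times> real) set \<Rightarrow> ('e \<times> real) set \<Rightarrow> real" where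
  "graph_dist G X Y = Inf {path_length \<gamma> | \<gamma>. path_from_to G X Y \<gamma>}"

definition diam :: "('e, 'x) mgraph_scheme \<Rightarrow> real" where
  "diam G = (GREATEST r. \<exists>X\<in>points G. \<exists>Y\<in>points G. r = graph_dist G X Y)"

definition metric_graph :: "('e, 'x) mgraph_scheme \<Rightarrow> bool" where
  "metric_graph G \<longleftrightarrow>
     finite (edges G) \<and> (\<forall>e\<in>edges G. len G e > 0) \<and>
     finite (glue G) \<and> glue G \<subseteq> places G \<times> places G \<and>
     (\<forall>X\<in>points G. \<forall>Y\<in>points G. \<exists>\<gamma>. path_from_to G X Y \<gamma>)"

text \<open>The common endpoint of the spikes is the class of all places \<open>(i, 0)\<close>.\<close>

definition star :: "nat \<Rightarrow> nat mgraph" where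
  "star s = \<lparr>edges = {..<s}, len = (\<lambda>_. 1), glue = {((i, 0), (j, 0)) | i j. i < s \<and> j < s}\<rparr>"

lemma same_point_star:
  "same_point (star s) =
     {(p, q). p \<in> places (star s) \<and> q \<in> places (star s) \<and> (p = q \<or> snd p = 0 \<and> snd q = 0)}"
proof -
  let ?R = "glue (star s) \<union> (glue (star s))\<inverse>"
  have R: "(p, q) \<in> ?R \<longleftrightarrow> snd p = 0 \<and> snd q = 0 \<and> fst p < s \<and> fst q < s" for p q
    by (cases p; cases q) (auto simp: star_def)
  have "p = q \<or> snd p = 0 \<and> snd q = 0" if "(p, q) \<in> ?R\<^sup>*" for p q
    using that by (induction rule: rtrancl_induct) (use R in blast)+
  moreover have "(p, q) \<in> ?R\<^sup>*"
    if "p \<in> places (star s)" "q \<in> places (star s)" "snd p = 0" "snd q = 0" for p q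
    using that R[of p q] by (intro r_into_rtrancl) (auto simp: places_def star_def)
  ultimately show ?thesis
    by (auto simp: same_point_def)
qed

lemma same_point_refl: "p \<in> places G \<Longrightarrow> (p, p) \<in> same_point G"
  by (simp add: same_point_def)

lemma equiv_same_point: "equiv (places G) (same_point G)"
proof (rule equivI)
  have "sym ((glue G \<union> (glue G)\<inverse>)\<^sup>*)"
    by (intro sym_rtrancl) (auto simp: sym_def)
  then show "sym (same_point G)"
    by (auto simp: same_point_def sym_def)
  show "trans (same_point G)"
    by (auto simp: same_point_def trans_def intro: rtrancl_trans)
  show "refl_on (places G) (same_point G)"
    by (auto simp: refl_on_def same_point_refl)
qed (auto simp: same_point_def)

lemma metric_graph_star: "metric_graph (star s)"
proof -
  have "glue (star s) = (\<lambda>(i, j). ((i, 0), (j, 0))) ` ({..<s} \<times> {..<s})"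
    by (auto simp: star_def)
  then have "finite (glue (star s))"
    by simp
  moreover have "\<exists>\<gamma>. path_from_to (star s) X Y \<gamma>"
    if X: "X \<in> points (star s)" and Y: "Y \<in> points (star s)" for X Y
  proof -
    obtain i t where it: "(i, t) \<in> places (star s)" "X = same_point (star s) `` {(i, t)}"
      using X by (auto simp: points_def elim!: quotientE)
    obtain j u where ju: "(j, u) \<in> places (star s)" "Y = same_point (star s) `` {(j, u)}"
      using Y by (auto simp: points_def elim!: quotientE)
    have "path_from_to (star s) X Y [(i, t, 0), (j, 0, u)]"
      using it ju by (auto simp: path_from_to_def same_point_star places_def)
    then show ?thesis ..
  qed
  ultimately show ?thesis
    by (auto simp: metric_graph_def star_def places_def)
qed

text \<open>
  Wormholes are pairs of points of the original graph, and all identifications are made at once.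
  A list of wormholes may contain repetitions.
\<close>

definition add_wormholes ::
    "(('e \<times> real) set \<times> ('e \<times> real) set) list \<Rightarrow> ('e, 'x) mgraph_scheme \<Rightarrow> ('e, 'x) mgraph_scheme"
  where
  "add_wormholes ws G = G\<lparr>glue := glue G \<union> (\<Union>(X, Y)\<in>set ws. X \<times> Y)\<rparr>"

lemma metric_graph_add_wormholes:
  assumes G: "metric_graph G" and ws: "set ws \<subseteq> points G \<times> points G"
  shows "metric_graph (add_wormholes ws G)"
proof -
  let ?H = "add_wormholes ws G"
  have eq: "edges ?H = edges G" "len ?H = len G" "places ?H = places G"
    by (simp_all add: add_wormholes_def places_def)
  have glue: "glue ?H = glue G \<union> (\<Union>(X, Y)\<in>set ws. X \<times> Y)"
    by (simp add: add_wormholes_def)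
  have sub: "X \<subseteq> places G" if "X \<in> points G" for X
    using that by (auto simp: points_def same_point_def elim!: quotientE)
  have fin: "finite X" if X: "X \<in> points G" for X
  proof -
    let ?F = "fst ` glue G \<union> snd ` glue G"
    obtain p where p: "X = same_point G `` {p}"
      using X unfolding points_def by (blast elim: quotientE)
    have "q = p \<or> q \<in> ?F" if "(p, q) \<in> (glue G \<union> (glue G)\<inverse>)\<^sup>*" for q
      using that by (induction rule: rtrancl_induct) force+
    then have "X \<subseteq> insert p ?F"
      using p by (auto simp: same_point_def)
    moreover have "finite (insert p ?F)"
      using G by (simp add: metric_graph_def)
    ultimately show ?thesis
      by (rule finite_subset)
  qed
  have mono: "same_point G \<subseteq> same_point ?H"
    unfolding same_point_def eq using glue
    by (intro Int_mono rtrancl_mono Un_mono) auto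
  have "\<exists>\<gamma>. path_from_to ?H X Y \<gamma>" if X: "X \<in> points ?H" and Y: "Y \<in> points ?H" for X Y
  proof -
    obtain p where p: "p \<in> places G" "X = same_point ?H `` {p}"
      using X unfolding points_def eq by (blast elim: quotientE)
    obtain q where q: "q \<in> places G" "Y = same_point ?H `` {q}"
      using Y unfolding points_def eq by (blast elim: quotientE)
    have "same_point G `` {p} \<in> points G" "same_point G `` {q} \<in> points G"
      using p q by (auto simp: points_def intro: quotientI)
    then obtain \<gamma> where \<gamma>: "path_from_to G (same_point G `` {p}) (same_point G `` {q}) \<gamma>"
      using G unfolding metric_graph_def by blast
    have "successively (\<lambda>\<sigma> \<tau>. (seg_end \<sigma>, seg_start \<tau>) \<in> same_point ?H) \<gamma>"
      using \<gamma> mono by (auto simp: path_from_to_def elim!: successively_mono)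
    then have "path_from_to ?H X Y \<gamma>"
      using \<gamma> mono p q by (auto simp: path_from_to_def eq)
    then show ?thesis ..
  qed
  moreover have "finite (glue ?H)"
    using G ws fin unfolding glue metric_graph_def by (auto intro!: finite_cartesian_product)
  moreover have "glue ?H \<subseteq> places G \<times> places G"
  proof -
    have "X \<times> Y \<subseteq> places G \<times> places G" if "(X, Y) \<in> set ws" for X Y
      using that ws by (intro Sigma_mono sub) auto
    then show ?thesis
      using G unfolding glue metric_graph_def by (intro Un_least UN_least) auto
  qed
  ultimately show ?thesis
    using G by (auto simp: metric_graph_def eq)
qed

end

theory Submission
  imports Defs
begin

text \<open>
  A function \<open>(i, t) \<mapsto> x\<^sub>i * t\<close> with \<open>\<bar>x\<^sub>i\<bar> \<le> 1\<close> is 1-Lipschitz on the star, and it descends to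
  \<open>G\<^sub>w\<close> if \<open>x\<close> satisfies one homogeneous linear equation per wormhole. These are \<open>s - 2\<close> equations
  in \<open>s\<close> unknowns, so the solutions form a space of dimension at least two. The odd continuous
  function \<open>x \<mapsto> max x + min x\<close> therefore vanishes at a nonzero solution, which can be scaled to
  \<open>max x = 1\<close> and \<open>min x = -1\<close>. The tips of two spikes where these values are attained have
  distance at least 2.
\<close>

section \<open>Homogeneous linear systems\<close>

text \<open>Gaussian elimination, by induction on the number of equations: a nonzero equation is
  used up together with one pivot unknown, so the surplus of unknowns is preserved.\<close>

lemma nontrivial_solution:
  fixes F :: "('a \<Rightarrow> real) list"
  assumes "finite I" "length F < card I"
  shows "\<exists>x. (\<exists>i\<in>I. x i \<noteq> 0) \<and> (\<forall>f\<in>set F. (\<Sum>i\<in>I. f i * x i) = 0)"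
  using assms
proof (induction "length F" arbitrary: F I)
  case 0
  then show ?case
    by (intro exI[of _ "\<lambda>_. 1"]) (auto simp: card_gt_0_iff)
next
  case (Suc n)
  obtain f F' where F: "F = f # F'" "length F' = n"
    using Suc.hyps(2) by (cases F) auto
  show ?case
  proof (cases "\<forall>i\<in>I. f i = 0")
    case True
    obtain x where "\<exists>i\<in>I. x i \<noteq> 0" "\<forall>f\<in>set F'. (\<Sum>i\<in>I. f i * x i) = 0"
      using Suc.hyps(1)[of F' I] Suc.prems F by auto
    then show ?thesis
      using True F by (intro exI[of _ x]) auto
  next
    case False
    then obtain k where k: "k \<in> I" "f k \<noteq> 0"
      by auto
    let ?J = "I - {k}"
    \<comment> \<open>Subtracting this multiple of \<open>f\<close> from \<open>g\<close> cancels
      the coefficient at the pivot \<open>k\<close>, leaving a system in the unknowns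
      \<open>?J\<close>.\<close>
    define elim where "elim g i = g i - g k * f i / f k" for g :: "'a \<Rightarrow> real" and i
    have "length (map elim F') < card ?J"
      using Suc.prems k F by simp
    then obtain x where x: "\<exists>i\<in>?J. x i \<noteq> 0"
        "\<forall>g\<in>set (map elim F'). (\<Sum>i\<in>?J. g i * x i) = 0"
      using Suc.hyps(1)[of "map elim F'" ?J] Suc.prems F by auto
    define S where "S = (\<Sum>i\<in>?J. f i * x i)"
    \<comment> \<open>Back substitution: the value at \<open>k\<close> is the one that solves the
      equation \<open>f\<close>.\<close>
    define y where "y = x(k := - S / f k)"
    have sum_y: "(\<Sum>i\<in>I. g i * y i) = (\<Sum>i\<in>?J. g i * x i) - g k * S / f k" for g
      using Suc.prems k by (simp add: y_def sum.remove[of I k])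
    have "(\<Sum>i\<in>I. g i * y i) = 0" if g: "g \<in> set F'" for g
    proof -
      have "0 = (\<Sum>i\<in>?J. elim g i * x i)"
        using x(2) g by auto
      also have "\<dots> = (\<Sum>i\<in>?J. g i * x i) - g k / f k * S"
        by (simp add: elim_def S_def sum_subtractf sum_distrib_left algebra_simps)
      finally show ?thesis
        by (simp add: sum_y)
    qed
    moreover have "(\<Sum>i\<in>I. f i * y i) = 0"
      using k by (simp add: sum_y S_def)
    moreover have "\<exists>i\<in>I. y i \<noteq> 0"
      using x(1) by (auto simp: y_def)
    ultimately show ?thesis
      using F by auto
  qed
qed

lemma continuous_on_Max_image:
  fixes f :: "'i \<Rightarrow> 'a::topological_space \<Rightarrow> real"
  assumes "finite I" "I \<noteq> {}" "\<And>i. i \<in> I \<Longrightarrow> continuous_on A (f i)"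
  shows "continuous_on A (\<lambda>t. Max ((\<lambda>i. f i t) ` I))"
  using assms by (induction rule: finite_ne_induct) (auto intro: continuous_on_max)

text \<open>A segment between two independent solutions misses the origin, so the intermediate value
  theorem along it yields the nonzero balanced solution.\<close>

lemma balanced_solution:
  fixes F :: "('a \<Rightarrow> real) list"
  assumes I: "finite I" and F: "length F + 2 \<le> card I"
  obtains x i j where "\<forall>f\<in>set F. (\<Sum>i\<in>I. f i * x i) = 0" "\<forall>i\<in>I. \<bar>x i\<bar> \<le> 1"
    "i \<in> I" "x i = 1" "j \<in> I" "x j = - 1"
proof -
  define sol where "sol x \<longleftrightarrow> (\<forall>f\<in>set F. (\<Sum>i\<in>I. f i * x i) = 0)" for x
  have sol_comb: "sol (\<lambda>i. a * x i + b * y i)" if "sol x" "sol y" for x y a b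
  proof -
    have "(\<Sum>i\<in>I. f i * (a * x i + b * y i)) = a * (\<Sum>i\<in>I. f i * x i) + b * (\<Sum>i\<in>I. f i * y i)" for f
      by (simp add: sum.distrib sum_distrib_left algebra_simps)
    then show ?thesis
      using that by (simp add: sol_def)
  qed
  have ne: "I \<noteq> {}"
    using F by auto
  obtain u k where u: "sol u" "k \<in> I" "u k \<noteq> 0"
    using nontrivial_solution[OF I, of F] F by (auto simp: sol_def)
  \<comment> \<open>The second spare dimension pays for the extra equation \<open>v k = 0\<close>,
    which makes \<open>v\<close> independent of \<open>u\<close>.\<close>
  obtain v where v: "\<exists>i\<in>I. v i \<noteq> 0" "sol v" "(\<Sum>i\<in>I. of_bool (i = k) * v i) = 0"
    using nontrivial_solution[OF I, of "(\<lambda>i. of_bool (i = k)) # F"] F by (auto simp: sol_def)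
  have vk: "v k = 0"
    using v(3) u(2) I by (simp add: of_bool_def if_distrib[of "\<lambda>c. c * _"] sum.delta cong: if_cong)
  \<comment> \<open>This is maximum plus minimum, the minimum being written as the negated maximum
    of \<open>- x\<close>; in this form oddness is immediate.\<close>
  define g where "g x = Max (x ` I) - Max ((\<lambda>i. - x i) ` I)" for x :: "'a \<Rightarrow> real"
  have g_minus: "g (\<lambda>i. - x i) = - g x" for x
    by (simp add: g_def)
  have sol_minus: "sol (\<lambda>i. - x i)" if "sol x" for x
    using sol_comb[of x x "- 1" 0] that by simp
  \<comment> \<open>Since \<open>g\<close> is odd, changing signs of \<open>u\<close> and
    \<open>v\<close> makes \<open>g\<close> nonnegative at one end of the segment and nonpositive at
    the other.\<close>
  obtain u' where u': "sol u'" "u' k \<noteq> 0" "0 \<le> g u'"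
    using u sol_minus[OF u(1)] g_minus[of u] by (cases "0 \<le> g u") force+
  obtain v' where v': "sol v'" "v' k = 0" "\<exists>i\<in>I. v' i \<noteq> 0" "g v' \<le> 0"
    using v(1,2) vk sol_minus[OF v(2)] g_minus[of v] by (cases "g v \<le> 0") force+
  \<comment> \<open>At \<open>k\<close> the value is \<open>(1 - t) * u' k\<close>, nonzero except
    at \<open>t = 1\<close>, where \<open>w t\<close> is the nonzero \<open>v'\<close>.\<close>
  define w where "w t i = (1 - t) * u' i + t * v' i" for t i
  have "continuous_on {0..1} (\<lambda>t. g (w t))"
    unfolding g_def w_def using I ne
    by (intro continuous_on_diff continuous_on_Max_image continuous_intros)
  then obtain t where t: "g (w t) = 0"
    using IVT2'[of "\<lambda>t. g (w t)" 1 0 0] u' v' by (auto simp: w_def[abs_def])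
  let ?x = "w t"
  \<comment> \<open>As \<open>g\<close> vanishes here, \<open>r\<close> is also the maximum of
    \<open>- ?x\<close>, hence the sup norm of \<open>?x\<close> on \<open>I\<close>; dividing by it
    gives the values 1 and -1.\<close>
  define r where "r = Max (?x ` I)"
  have r: "Max ((\<lambda>i. - ?x i) ` I) = r"
    using t by (simp add: g_def r_def)
  have le: "?x i \<le> r" "- ?x i \<le> r" if "i \<in> I" for i
  proof -
    show "?x i \<le> r"
      using I that by (simp add: r_def)
    show "- ?x i \<le> r"
      using I that by (simp flip: r)
  qed
  have "\<exists>i\<in>I. ?x i \<noteq> 0"
  proof (cases "t = 1")
    case True
    then show ?thesis
      using v' by (simp add: w_def)
  next
    case False
    then have "?x k \<noteq> 0"
      using u' v' by (simp add: w_def)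
    then show ?thesis
      using u by blast
  qed
  then have "r > 0"
    using le by force
  obtain i where i: "i \<in> I" "?x i = r"
    using Max_in[of "?x ` I"] I ne unfolding r_def[symmetric] by auto
  obtain j where j: "j \<in> I" "- ?x j = r"
    using Max_in[of "(\<lambda>i. - ?x i) ` I"] I ne unfolding r by auto
  have "sol ?x"
    using sol_comb[OF u'(1) v'(1)] by (simp add: w_def[abs_def])
  then have "sol (\<lambda>i. ?x i / r)"
    using sol_comb[of ?x ?x "1 / r" 0] by simp
  moreover have "\<forall>i\<in>I. \<bar>?x i / r\<bar> \<le> 1"
    using le \<open>r > 0\<close> by (auto simp: abs_le_iff)
  moreover have "?x i / r = 1" "?x j / r = - 1"
    using i j \<open>r > 0\<close> by (auto simp: field_simps)
  ultimately show ?thesis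
    using that[of "\<lambda>i. ?x i / r" i j] i(1) j(1) unfolding sol_def by blast
qed

section \<open>Distances in metric graphs\<close>

lemma path_length_nonneg:
  fixes \<gamma> :: "('e \<times> real \<times> real) list"
  shows "0 \<le> path_length \<gamma>"
proof -
  have "0 \<le> seg_length \<sigma>" for \<sigma> :: "'e \<times> real \<times> real"
    by (cases \<sigma>) auto
  then show ?thesis
    unfolding path_length_def by (intro sum_list_nonneg) auto
qed

lemma graph_dist_le:
  assumes "path_from_to G X Y \<gamma>"
  shows "graph_dist G X Y \<le> path_length \<gamma>"
  unfolding graph_dist_def using assms path_length_nonneg
  by (intro cInf_lower bdd_belowI[where m = 0]) auto

text \<open>The increments of \<open>\<phi>\<close> telescope: passing from one segment to the next
  stays at the same point and leaves \<open>\<phi>\<close> unchanged.\<close>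

lemma lipschitz_path_length:
  fixes \<phi> :: "'e \<times> real \<Rightarrow> real"
  assumes "\<gamma> \<noteq> []"
    and "\<And>p q. (p, q) \<in> same_point G \<Longrightarrow> \<phi> p = \<phi> q"
    and "\<And>\<sigma>. \<sigma> \<in> set \<gamma> \<Longrightarrow> \<phi> (seg_end \<sigma>) - \<phi> (seg_start \<sigma>) \<le> seg_length \<sigma>"
    and "successively (\<lambda>\<sigma> \<tau>. (seg_end \<sigma>, seg_start \<tau>) \<in> same_point G) \<gamma>"
  shows "\<phi> (seg_end (last \<gamma>)) - \<phi> (seg_start (hd \<gamma>)) \<le> path_length \<gamma>"
  using assms
proof (induction \<gamma> rule: list_nonempty_induct)
  case (single \<sigma>)
  then show ?case
    by (simp add: path_length_def)
next
  case (cons \<sigma> \<gamma>)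
  have "\<phi> (seg_end \<sigma>) = \<phi> (seg_start (hd \<gamma>))"
    using cons by (auto simp: successively_Cons)
  moreover have "\<phi> (seg_end (last \<gamma>)) - \<phi> (seg_start (hd \<gamma>)) \<le> path_length \<gamma>"
    using cons by (auto simp: successively_Cons)
  moreover have "\<phi> (seg_end \<sigma>) - \<phi> (seg_start \<sigma>) \<le> seg_length \<sigma>"
    using cons by simp
  ultimately show ?case
    using cons by (simp add: path_length_def)
qed

text \<open>The difference of \<open>\<phi>\<close> bounds every path length from below, hence also
  the infimum; the given path shows that the infimum is over a nonempty set.\<close>

lemma graph_dist_ge_lipschitz:
  fixes \<phi> :: "'e \<times> real \<Rightarrow> real"
  assumes same: "\<And>p q. (p, q) \<in> same_point G \<Longrightarrow> \<phi> p = \<phi> q"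
    and lip: "\<And>e a b. e \<in> edges G \<Longrightarrow> \<bar>\<phi> (e, b) - \<phi> (e, a)\<bar> \<le> \<bar>b - a\<bar>"
    and ex: "path_from_to G (same_point G `` {p}) (same_point G `` {q}) \<gamma>"
  shows "\<phi> q - \<phi> p \<le> graph_dist G (same_point G `` {p}) (same_point G `` {q})"
  unfolding graph_dist_def
proof (rule cInf_greatest)
  fix l assume "l \<in> {path_length \<gamma> |\<gamma>. path_from_to G (same_point G `` {p}) (same_point G `` {q}) \<gamma>}"
  then obtain \<gamma> where l: "l = path_length \<gamma>"
    and \<gamma>: "path_from_to G (same_point G `` {p}) (same_point G `` {q}) \<gamma>"
    by auto
  have "\<phi> (seg_end \<sigma>) - \<phi> (seg_start \<sigma>) \<le> seg_length \<sigma>" if "\<sigma> \<in> set \<gamma>" for \<sigma>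
  proof (cases \<sigma>)
    case (fields e a b)
    then have "e \<in> edges G"
      using \<gamma> that by (force simp: path_from_to_def places_def)
    then show ?thesis
      using lip[of e b a] fields by simp
  qed
  then have "\<phi> (seg_end (last \<gamma>)) - \<phi> (seg_start (hd \<gamma>)) \<le> path_length \<gamma>"
    using lipschitz_path_length[of \<gamma> G \<phi>] same \<gamma> by (simp add: path_from_to_def)
  moreover have "\<phi> p = \<phi> (seg_start (hd \<gamma>))" "\<phi> q = \<phi> (seg_end (last \<gamma>))"
    using \<gamma> same by (auto simp: path_from_to_def)
  ultimately show "\<phi> q - \<phi> p \<le> l"
    by (simp add: l)
qed (use ex in auto)

lemma same_point_invariant:
  assumes "\<And>p q. (p, q) \<in> glue G \<Longrightarrow> \<phi> p = \<phi> q" and "(p, q) \<in> same_point G"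
  shows "\<phi> p = \<phi> q"
proof -
  have "(p, q) \<in> (glue G \<union> (glue G)\<inverse>)\<^sup>*"
    using assms(2) by (simp add: same_point_def)
  then show ?thesis
    by (induction rule: rtrancl_induct) (use assms(1) in fastforce)+
qed

section \<open>The star with wormholes\<close>

lemma places_star_wormholes: "places (add_wormholes ws (star s)) = {..<s} \<times> {0..1}"
  by (auto simp: places_def add_wormholes_def star_def)

lemma centre_star_wormholes:
  assumes "i < s" "j < s"
  shows "((i, 0), (j, 0)) \<in> same_point (add_wormholes ws (star s))"
proof -
  have "((i, 0), (j, 0)) \<in> glue (add_wormholes ws (star s))"
    using assms by (auto simp: add_wormholes_def star_def)
  then show ?thesis
    using assms by (auto simp: same_point_def places_star_wormholes)
qed

text \<open>Going down one spike and up another has length at most 2. This gives the upper bound on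
  distances and the path required for the lower bound.\<close>

lemma path_through_centre:
  assumes "p \<in> places (add_wormholes ws (star s))" "q \<in> places (add_wormholes ws (star s))"
  shows "path_from_to (add_wormholes ws (star s))
    (same_point (add_wormholes ws (star s)) `` {p}) (same_point (add_wormholes ws (star s)) `` {q})
    [(fst p, snd p, 0), (fst q, 0, snd q)]"
  using assms centre_star_wormholes[of "fst p" s "fst q" ws]
  by (auto simp: path_from_to_def places_star_wormholes same_point_refl)

text \<open>The function is already well defined on the star, being 0 at the centre, so one equation
  between chosen representatives settles all pairs glued by a wormhole.\<close>

lemma wormhole_invariant_star:
  assumes x: "\<And>X Y. (X, Y) \<in> set ws \<Longrightarrow> \<exists>p\<in>X. \<exists>q\<in>Y. x (fst p) * snd p = x (fst q) * snd q"
    and ws: "set ws \<subseteq> points (star s) \<times> points (star s)"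
    and pq: "(p, q) \<in> same_point (add_wormholes ws (star s))"
  shows "x (fst p) * snd p = x (fst q) * (snd q :: real)"
proof (rule same_point_invariant[OF _ pq])
  have const: "x (fst p) * snd p = x (fst q) * snd q" if "X \<in> points (star s)" "p \<in> X" "q \<in> X" for X p q
    using that by (auto simp: points_def same_point_star elim!: quotientE)
  fix p q assume "(p, q) \<in> glue (add_wormholes ws (star s))"
  then consider "(p, q) \<in> glue (star s)" | X Y where "(X, Y) \<in> set ws" "p \<in> X" "q \<in> Y"
    by (auto simp: add_wormholes_def)
  then show "x (fst p) * snd p = x (fst q) * snd q"
  proof cases
    case 1
    then show ?thesis
      by (auto simp: star_def)
  next
    case 2
    then obtain p' q' where "p' \<in> X" "q' \<in> Y" "x (fst p') * snd p' = x (fst q') * snd q'"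
      using x by blast
    then show ?thesis
      using const[of X p p'] const[of Y q q'] 2 ws by auto
  qed
qed

text \<open>Allowing fewer than \<open>s - 2\<close> wormholes lets the same result cover the plain
  star.\<close>

lemma diam_star_wormholes:
  assumes ws: "set ws \<subseteq> points (star s) \<times> points (star s)" and s: "length ws + 2 \<le> s"
  shows "diam (add_wormholes ws (star s)) = 2"
proof -
  let ?H = "add_wormholes ws (star s)"
  have upper: "graph_dist ?H X Y \<le> 2" if X: "X \<in> points ?H" and Y: "Y \<in> points ?H" for X Y
  proof -
    obtain p where p: "p \<in> places ?H" "X = same_point ?H `` {p}"
      using X unfolding points_def by (blast elim: quotientE)
    obtain q where q: "q \<in> places ?H" "Y = same_point ?H `` {q}"
      using Y unfolding points_def by (blast elim: quotientE)
    show ?thesis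
      using graph_dist_le[OF path_through_centre[OF p(1) q(1)]] p q
      by (auto simp: path_length_def places_star_wormholes)
  qed
  define rep :: "(nat \<times> real) set \<Rightarrow> nat \<times> real" where "rep X = (SOME p. p \<in> X)" for X
  have rep: "rep X \<in> X" if "X \<in> points (star s)" for X
  proof -
    have "X \<noteq> {}"
      using in_quotient_imp_non_empty[OF equiv_same_point] that by (auto simp: points_def)
    then show ?thesis
      by (auto simp: rep_def some_in_eq)
  qed
  have rep_less: "fst (rep X) < s" if "X \<in> points (star s)" for X
  proof -
    have "rep X \<in> places (star s)"
      using rep[OF that] that by (auto simp: points_def same_point_star elim!: quotientE)
    then show ?thesis
      by (auto simp: places_def star_def)
  qed
  \<comment> \<open>The row of the equation for one wormhole. The two terms are subtracted, so it is
    also correct when both representatives lie on the same spike.\<close>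
  define coeff where
    "coeff = (\<lambda>(X, Y) i. of_bool (i = fst (rep X)) * snd (rep X) - of_bool (i = fst (rep Y)) * snd (rep Y))"
  have sum_coeff: "(\<Sum>i<s. coeff (X, Y) i * x i) = x (fst (rep X)) * snd (rep X) - x (fst (rep Y)) * snd (rep Y)"
    if "X \<in> points (star s)" "Y \<in> points (star s)" for X Y and x :: "nat \<Rightarrow> real"
    using rep_less[OF that(1)] rep_less[OF that(2)]
    by (simp add: coeff_def algebra_simps sum_subtractf of_bool_def if_distrib[of "\<lambda>c. _ * c"] sum.delta cong: if_cong)
  obtain x i j where x: "\<forall>f\<in>set (map coeff ws). (\<Sum>i<s. f i * x i) = 0" "\<forall>i\<in>{..<s}. \<bar>x i\<bar> \<le> 1"
    and i: "i \<in> {..<s}" "x i = 1" and j: "j \<in> {..<s}" "x j = - 1"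
    using balanced_solution[of "{..<s}" "map coeff ws"] s by auto
  have worm: "\<exists>p\<in>X. \<exists>q\<in>Y. x (fst p) * snd p = x (fst q) * snd q" if XY: "(X, Y) \<in> set ws" for X Y
  proof -
    have "X \<in> points (star s)" "Y \<in> points (star s)"
      using XY ws by auto
    moreover have "(\<Sum>i<s. coeff (X, Y) i * x i) = 0"
      using x(1) XY by auto
    ultimately show ?thesis
      using rep sum_coeff by force
  qed
  let ?X = "same_point ?H `` {(j, 1)}" and ?Y = "same_point ?H `` {(i, 1)}"
  have tips: "(j, 1) \<in> places ?H" "(i, 1) \<in> places ?H"
    using i j by (auto simp: places_star_wormholes)
  have lip: "\<bar>x e * b - x e * a\<bar> \<le> \<bar>b - a\<bar>" if "e \<in> edges ?H" for e a b
  proof -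
    have "\<bar>x e\<bar> \<le> 1"
      using x(2) that by (auto simp: add_wormholes_def star_def)
    then have "\<bar>x e\<bar> * \<bar>b - a\<bar> \<le> 1 * \<bar>b - a\<bar>"
      by (intro mult_right_mono) auto
    then show ?thesis
      by (simp add: abs_mult flip: right_diff_distrib)
  qed
  \<comment> \<open>The function is -1 at the tip of spike \<open>j\<close> and 1 at the tip of
    spike \<open>i\<close>.\<close>
  have "2 \<le> graph_dist ?H ?X ?Y"
    using graph_dist_ge_lipschitz[where \<phi> = "\<lambda>p. x (fst p) * snd p",
        OF wormhole_invariant_star[OF worm ws] _ path_through_centre[OF tips]] lip i j
    by simp
  moreover have XY: "?X \<in> points ?H" "?Y \<in> points ?H"
    using tips by (auto simp: points_def intro: quotientI)
  ultimately have "graph_dist ?H ?X ?Y = 2"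
    using upper by (intro antisym)
  then show ?thesis
    unfolding diam_def using XY upper
    by (intro Greatest_equality) (blast intro: sym)+
qed

theorem proposition10:
  fixes s :: nat
    and ws :: "((nat \<times> real) set \<times> (nat \<times> real) set) list"
  assumes "s \<ge> 2"
    and "set ws \<subseteq> points (star s) \<times> points (star s)"
    and "length ws = s - 2"
  shows "diam (add_wormholes ws (star s)) = diam (star s) \<and> diam (star s) = 2"
proof -
  have "add_wormholes [] (star s) = star s"
    by (simp add: add_wormholes_def)
  then show ?thesis
    using diam_star_wormholes[of ws s] diam_star_wormholes[of "[]" s] assms by simp
qed

end
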